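(* Let $F\in A^2 (\Pi^+)$ be such that $\left \Vert F\right \Vert_{A^2 (\Pi^+)}=1$. Then $$\int_{\Pi^+} \log \left [\frac 1{2\sqrt \pi\,|F(x+iy)|\,y} \right ]|F(x+iy)|^{2}\,dx\,dy\geq \frac {\log 3}2.$$
   Context: $\Pi^+=\{x+iy\in\mathbb{C}: y>0\}$ is the upper half-plane. $A^2(\Pi^+)$ is the Bergman space of holomorphic functions $F$ on $\Pi^+$ with $\|F\|_{A^2(\Pi^+)}:=\left(\int_{\Pi^+}|F(x+iy)|^2\,dx\,dy\right)^{1/2}<\infty$. *)

theory Defs
  imports "HOL-Complex_Analysis.Complex_Analysis"
begin

definition upper_half_plane :: "complex set" where
  "upper_half_plane = {z. 0 < Im z}"

text \<open>\<^term>\<open>lborel\<close> on the complex numbers is the planar Lebesgue measure \<open>dx dy\<close>.\<close>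

definition bergman_space :: "(complex \<Rightarrow> complex) set" where
  "bergman_space =
     {F. F holomorphic_on upper_half_plane \<and>
         set_integrable lborel upper_half_plane (\<lambda>z. (cmod (F z))\<^sup>2)}"

definition bergman_norm :: "(complex \<Rightarrow> complex) \<Rightarrow> real" where
  "bergman_norm F =
     sqrt (set_lebesgue_integral lborel upper_half_plane (\<lambda>z. (cmod (F z))\<^sup>2))"

text \<open>
  The Lebesgue integral with values in the extended reals. The Bochner integral is 0 on
  non-integrable functions, so it cannot be used for integrals that may be infinite.
  \<open>set_ereal_integral\<close> is meaningful only under \<open>set_quasi_integrable\<close>, which
  excludes the case \<open>\<infinity> - \<infinity>\<close>.
\<close>

definition set_quasi_integrable :: "'a measure \<Rightarrow> 'a set \<Rightarrow> ('a \<Rightarrow> real) \<Rightarrow> bool" where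
  "set_quasi_integrable M A f \<longleftrightarrow>
     set_borel_measurable M A f \<and>
     ((\<integral>\<^sup>+x\<in>A. ennreal (f x) \<partial>M) < \<infinity> \<or> (\<integral>\<^sup>+x\<in>A. ennreal (- f x) \<partial>M) < \<infinity>)"

text \<open>
  \<^term>\<open>ennreal\<close> sends negative reals to 0, so the two terms below are the integrals of the
  positive and the negative part of \<open>f\<close>.
\<close>

definition set_ereal_integral :: "'a measure \<Rightarrow> 'a set \<Rightarrow> ('a \<Rightarrow> real) \<Rightarrow> ereal" where
  "set_ereal_integral M A f =
     enn2ereal (\<integral>\<^sup>+x\<in>A. ennreal (f x) \<partial>M) - enn2ereal (\<integral>\<^sup>+x\<in>A. ennreal (- f x) \<partial>M)"

text \<open>
  At a zero of \<open>F\<close> the value is 0, the usual convention for \<open>t\<^sup>2 log (1/t)\<close> at \<open>t = 0\<close>.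
\<close>

definition entropy_integrand :: "(complex \<Rightarrow> complex) \<Rightarrow> complex \<Rightarrow> real" where
  "entropy_integrand F z = ln (1 / (2 * sqrt pi * cmod (F z) * Im z)) * (cmod (F z))\<^sup>2"

end

theory Submission
  imports Defs
begin

text \<open>
  Write \<open>u(z) = 2 \<surd>\<pi> |F(z)| Im z\<close>, so that the integrand is \<open>- ln u |F|\<^sup>2\<close> and
  \<open>|F|\<^sup>2 dx dy\<close> is a probability measure. Concavity of the logarithm bounds the entropy from
  below by \<open>- (1/2) ln (\<integral> u\<^sup>2 |F|\<^sup>2)\<close>, so everything follows from the contractive estimate
  \<open>\<integral> u\<^sup>2 |F|\<^sup>2 \<le> 1/3\<close>, that is \<open>\<integral> |F|\<^sup>4 (Im z)\<^sup>2 \<le> 1 / (12 \<pi>)\<close>. Instead of Jensen's inequality, the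
  tangent line \<open>ln (3 u\<^sup>2) \<le> 3 u\<^sup>2 - 1\<close> at the expected mean value \<open>1/3\<close> of \<open>u\<^sup>2\<close> is used pointwise
  (\<open>entropy_integrand_lower_bound\<close>). A pointwise bound also shows that the negative part of the
  integrand is integrable, and it covers the case that the entropy is infinite.

  The contractive estimate (\<open>half_plane_L4_contraction\<close>) is conformally invariant: with the Cayley
  map \<open>\<phi>\<close> from the unit disc onto the half-plane and \<open>f = (F \<circ> \<phi>) \<phi>'\<close> it becomes
  \<open>\<integral> |f|\<^sup>4 (1 - |w|\<^sup>2)\<^sup>2 \<le> (\<integral> |f|\<^sup>2)\<^sup>2 / (3 \<pi>)\<close> on the disc (\<open>unit_disc_L4_contraction\<close>). There it is a
  statement about Taylor coefficients. Monomials are orthogonal for radial weights, so if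
  \<open>f = \<Sum> a\<^sub>n w\<^sup>n\<close> and \<open>f\<^sup>2 = \<Sum> c\<^sub>n w\<^sup>n\<close>, then (\<open>Parseval_unit_disc\<close> and the two moment computations)
  \<open>\<integral> |f|\<^sup>2 = \<pi> \<Sum> |a\<^sub>n|\<^sup>2 / (n+1)\<close> and
  \<open>\<integral> |f|\<^sup>4 (1 - |w|\<^sup>2)\<^sup>2 = 2 \<pi> \<Sum> |c\<^sub>n|\<^sup>2 / ((n+1)(n+2)(n+3))\<close>. The Cauchy-Schwarz inequality for
  \<open>c\<^sub>n = \<Sum> a\<^sub>i a\<^sub>n\<^sub>-\<^sub>i\<close> with the weights \<open>(i+1)(n-i+1)\<close>, whose sum over \<open>i \<le> n\<close> is exactly
  \<open>(n+1)(n+2)(n+3)/6\<close>, bounds the second series by \<open>\<pi>/3\<close> times the Cauchy square of the series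
  \<open>\<Sum> |a\<^sub>n|\<^sup>2 / (n+1)\<close>.
\<close>

(* Lets the dollar sign below denote vector components only. *)
unbundle no fps_syntax

section \<open>Conformal change of variables\<close>

text \<open>
  Translates between the nonnegative integral and the absolute integrability predicate in which the
  change of variables theorem on \<open>real ^ 'm\<close> is phrased.
\<close>
lemma nn_set_integral_eq_iff_absolutely_integrable:
  fixes f :: "'a::euclidean_space \<Rightarrow> real"
  assumes meas: "set_borel_measurable borel S f"
    and nonneg: "\<And>x. x \<in> S \<Longrightarrow> 0 \<le> f x" and b: "0 \<le> b"
  shows "(\<integral>\<^sup>+x\<in>S. f x \<partial>lborel) = ennreal b \<longleftrightarrow>
         f absolutely_integrable_on S \<and> integral S f = b"
proof
  assume I: "(\<integral>\<^sup>+x\<in>S. f x \<partial>lborel) = ennreal b"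
  have "set_integrable lborel S f"
  proof -
    have "(\<integral>\<^sup>+x. ennreal (norm (indicator S x *\<^sub>R f x)) \<partial>lborel) = (\<integral>\<^sup>+x\<in>S. f x \<partial>lborel)"
      by (intro nn_integral_cong) (auto simp: indicator_def nonneg)
    then show ?thesis
      using meas I unfolding set_integrable_def set_borel_measurable_def
      by (intro integrableI_bounded) auto
  qed
  then have "f absolutely_integrable_on S"
    unfolding set_integrable_def
    by (subst integrable_completion) (auto dest: borel_measurable_integrable)
  moreover have "integral S f = b"
  proof -
    have "ennreal b = ennreal (integral S f)"
      using set_nn_integral_lborel_eq_integral[OF meas nonneg] I by simp
    moreover have "0 \<le> integral S f"
      using calculation nonneg \<open>f absolutely_integrable_on S\<close>
      by (intro Henstock_Kurzweil_Integration.integral_nonneg) (auto simp: absolutely_integrable_on_def)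
    ultimately show ?thesis using b by simp
  qed
  ultimately show "f absolutely_integrable_on S \<and> integral S f = b" ..
next
  assume "f absolutely_integrable_on S \<and> integral S f = b"
  then have "(f has_integral b) S"
    using set_lebesgue_integral_eq_integral(1) by blast
  from nn_integral_has_integral_lebesgue'[OF nonneg this]
  show "(\<integral>\<^sup>+x\<in>S. f x \<partial>lborel) = ennreal b" by simp
qed

text \<open>
  An equality of nonnegative integrals, possibly infinite: each side equals a given finite value if
  and only if the other does. The multivariate theorem takes values in \<open>real ^ 'n\<close>, hence the
  detour through one-dimensional vectors.
\<close>
lemma nn_integral_change_of_variables:
  fixes f :: "real^'m::{finite,wellorder} \<Rightarrow> real" and g :: "real^'m::_ \<Rightarrow> real^'m::_"
  assumes S: "S \<in> sets lebesgue"
    and der: "\<And>x. x \<in> S \<Longrightarrow> (g has_derivative g' x) (at x within S)"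
    and inj: "inj_on g S"
    and meas: "set_borel_measurable borel (g ` S) f"
      "set_borel_measurable borel S (\<lambda>x. \<bar>det (matrix (g' x))\<bar> * f (g x))"
    and nonneg: "\<And>y. y \<in> g ` S \<Longrightarrow> 0 \<le> f y"
  shows "(\<integral>\<^sup>+y\<in>g ` S. f y \<partial>lborel) =
         (\<integral>\<^sup>+x\<in>S. \<bar>det (matrix (g' x))\<bar> * f (g x) \<partial>lborel)"
proof -
  have vec: "(\<lambda>x. \<chi> (i::1). h x) absolutely_integrable_on A \<and> integral A (\<lambda>x. \<chi> i. h x) = (\<chi> (i::1). b)
      \<longleftrightarrow> h absolutely_integrable_on A \<and> integral A h = b" (is "?L \<longleftrightarrow> ?R")
    for h :: "real^'m::_ \<Rightarrow> real" and A b
  proof -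
    have *: "(\<lambda>x. \<chi> (i::1). h x) absolutely_integrable_on A \<longleftrightarrow> h absolutely_integrable_on A"
      by (subst absolutely_integrable_componentwise_iff) (simp add: Basis_vec_def inner_axis)
    have "integral A (\<lambda>x. \<chi> (i::1). h x) = (\<chi> (i::1). integral A h)" if "h integrable_on A"
    proof -
      have "((\<lambda>x. \<chi> (i::1). h x) has_integral (\<chi> (i::1). integral A h)) A"
        by (subst has_integral_componentwise_iff)
          (simp add: Basis_vec_def inner_axis integrable_integral[OF that])
      then show ?thesis by (rule integral_unique)
    qed
    then show ?thesis
      using * set_lebesgue_integral_eq_integral(1)[of A h] by (auto simp: vec_eq_iff)
  qed
  have scale: "c *\<^sub>R (\<chi> (i::1). r) = (\<chi> i. c * r)" for c r :: real
    by (simp add: vec_eq_iff)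
  have iff: "(\<lambda>x. \<bar>det (matrix (g' x))\<bar> * f (g x)) absolutely_integrable_on S \<and>
      integral S (\<lambda>x. \<bar>det (matrix (g' x))\<bar> * f (g x)) = b
     \<longleftrightarrow> f absolutely_integrable_on (g ` S) \<and> integral (g ` S) f = b" for b
    using has_absolute_integral_change_of_variables[OF S der inj,
        of "\<lambda>x. \<chi> (i::1). f x" "\<chi> (i::1). b"]
    unfolding scale vec .
  have nonneg2: "0 \<le> \<bar>det (matrix (g' x))\<bar> * f (g x)" if "x \<in> S" for x
    using nonneg that by simp
  have eq: "(\<integral>\<^sup>+y\<in>g ` S. f y \<partial>lborel) = ennreal b \<longleftrightarrow>
        (\<integral>\<^sup>+x\<in>S. \<bar>det (matrix (g' x))\<bar> * f (g x) \<partial>lborel) = ennreal b" if "0 \<le> b" for b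
    using nn_set_integral_eq_iff_absolutely_integrable[OF meas(1) nonneg that]
      nn_set_integral_eq_iff_absolutely_integrable[OF meas(2) nonneg2 that] iff by simp
  show ?thesis
  proof (cases "(\<integral>\<^sup>+y\<in>g ` S. f y \<partial>lborel)" rule: ennreal_cases)
    case (real r)
    then show ?thesis using eq[of r] by simp
  next
    case top
    show ?thesis
    proof (cases "(\<integral>\<^sup>+x\<in>S. \<bar>det (matrix (g' x))\<bar> * f (g x) \<partial>lborel)" rule: ennreal_cases)
      case (real r)
      then show ?thesis using eq[of r] by simp
    next
      case top
      with \<open>(\<integral>\<^sup>+y\<in>g ` S. f y \<partial>lborel) = top\<close> show ?thesis by simp
    qed
  qed
qed

lemma lborel_complex_eq_distr:
  "(lborel :: complex measure) = distr (lborel :: (real^2) measure) borel (\<lambda>x. Complex (x$1) (x$2))"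
proof (rule lborel_eqI)
  have [measurable]: "(\<lambda>x::real^2. Complex (x$1) (x$2)) \<in> borel_measurable borel"
    by (intro borel_measurable_continuous_onI) (simp add: Complex_eq continuous_intros)
  fix l u :: complex
  assume le: "\<And>b. b \<in> Basis \<Longrightarrow> l \<bullet> b \<le> u \<bullet> b"
  have "(\<lambda>x::real^2. Complex (x$1) (x$2)) -` box l u = box (vector [Re l, Im l]) (vector [Re u, Im u])"
    by (auto simp: box_def Basis_complex_def Basis_vec_def inner_axis UNIV_2 vector_2)
  moreover have "(\<Prod>b\<in>Basis. (vector [Re u, Im u] - vector [Re l, Im l] :: real^2) \<bullet> b) = (\<Prod>b\<in>Basis. (u - l) \<bullet> b)"
  proof -
    have B: "(Basis :: (real^2) set) = {axis 1 1, axis 2 1}"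
      by (auto simp: Basis_vec_def UNIV_2)
    show ?thesis unfolding B
      by (simp add: Basis_complex_def inner_axis vector_2 axis_eq_axis)
  qed
  moreover have "\<forall>b\<in>Basis. (vector [Re l, Im l]:: real^2) \<bullet> b \<le> (vector [Re u, Im u]) \<bullet> b"
    using le[of 1] le[of \<i>] by (auto simp: Basis_complex_def Basis_vec_def inner_axis UNIV_2 vector_2)
  ultimately show "emeasure (distr lborel borel (\<lambda>x::real^2. Complex (x$1) (x$2))) (box l u) =
       (\<Prod>b\<in>Basis. (u - l) \<bullet> b)"
    by (simp add: emeasure_distr emeasure_lborel_box_eq)
qed simp

text \<open>
  Under the identification of \<open>complex\<close> with \<open>real ^ 2\<close>, multiplication by \<open>c\<close> is the matrix
  with rows \<open>(Re c, - Im c)\<close> and \<open>(Im c, Re c)\<close>, whose determinant is \<open>|c|\<^sup>2\<close>.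
\<close>
lemma nn_integral_holomorphic_change_of_variables:
  fixes f :: "complex \<Rightarrow> real" and g :: "complex \<Rightarrow> complex"
  assumes S: "open S" and g: "g holomorphic_on S" and inj: "inj_on g S"
    and cont: "continuous_on (g ` S) f"
    and nonneg: "\<And>z. z \<in> g ` S \<Longrightarrow> 0 \<le> f z"
  shows "(\<integral>\<^sup>+z\<in>g ` S. f z \<partial>lborel) =
         (\<integral>\<^sup>+w\<in>S. (cmod (deriv g w))\<^sup>2 * f (g w) \<partial>lborel)"
proof -
  define T :: "real^2 \<Rightarrow> complex" where "T = (\<lambda>x. Complex (x$1) (x$2))"
  define U :: "complex \<Rightarrow> real^2" where "U = (\<lambda>z. vector [Re z, Im z])"
  have TU [simp]: "T (U z) = z" and UT [simp]: "U (T x) = x" for z x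
    by (auto simp: T_def U_def vec_eq_iff forall_2)
  have T_lin: "bounded_linear T"
  proof -
    have "T = (\<lambda>x. of_real (x$1) + \<i> * of_real (x$2))"
      by (simp add: T_def Complex_eq)
    moreover have "bounded_linear (\<lambda>x::real^2. complex_of_real (x$1) + \<i> * of_real (x$2))"
      by (intro bounded_linear_add bounded_linear_compose[OF bounded_linear_of_real]
          bounded_linear_compose[OF bounded_linear_mult_right] bounded_linear_vec_nth)
    ultimately show ?thesis by simp
  qed
  have U_lin: "bounded_linear U"
    by (rule linear_conv_bounded_linear[THEN iffD1])
      (auto intro!: linearI simp: U_def vec_eq_iff forall_2)
  have contT: "continuous_on A T" for A
    using T_lin linear_continuous_on by blast
  have contU: "continuous_on A U" for A
    using U_lin linear_continuous_on by blast
  have [measurable]: "T \<in> borel_measurable borel"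
    by (intro borel_measurable_continuous_onI contT)
  have lb: "(lborel :: complex measure) = distr lborel borel T"
    unfolding T_def by (rule lborel_complex_eq_distr)
  define S' where "S' = T -` S"
  have openS': "open S'" unfolding S'_def using S contT by (rule open_vimage)
  define G where "G = U \<circ> g \<circ> T"
  define G' where "G' = (\<lambda>x h. U (deriv g (T x) * T h))"
  have opengS: "open (g ` S)" using open_mapping_thm3[OF g S inj] .
  have im: "G ` S' = T -` (g ` S)"
  proof -
    have "T ` S' = S" unfolding S'_def by (metis TU surj_def surj_image_vimage_eq)
    have "G ` S' = U ` g ` T ` S'" by (simp add: G_def image_comp)
    also have "\<dots> = U ` (g ` S)" using \<open>T ` S' = S\<close> by simp
    also have "\<dots> = T -` (g ` S)" by (auto simp: image_iff) (metis UT)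
    finally show ?thesis .
  qed
  have der: "(G has_derivative G' x) (at x within S')" if "x \<in> S'" for x
  proof -
    have "(g has_field_derivative deriv g (T x)) (at (T x))"
      using that g S holomorphic_derivI unfolding S'_def by blast
    then have "(g has_derivative (*) (deriv g (T x))) (at (T x))"
      by (simp add: has_field_derivative_def)
    moreover have "(T has_derivative T) (at x)"
      using T_lin by (rule bounded_linear_imp_has_derivative)
    ultimately have "((\<lambda>x. g (T x)) has_derivative (\<lambda>h. deriv g (T x) * T h)) (at x)"
      by (rule has_derivative_compose[rotated])
    from has_derivative_compose[OF this, of U U]
    have "((\<lambda>x. U (g (T x))) has_derivative G' x) (at x)"
      using U_lin by (simp add: bounded_linear_imp_has_derivative G'_def)
    then show ?thesis by (simp add: G_def comp_def has_derivative_at_withinI)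
  qed
  have det: "det (matrix (G' x)) = (cmod (deriv g (T x)))\<^sup>2" for x
  proof -
    have "det (matrix (G' x)) = Re (deriv g (T x)) * Re (deriv g (T x)) + Im (deriv g (T x)) * Im (deriv g (T x))"
      by (simp add: matrix_def G'_def det_2 U_def T_def axis_def)
    then show ?thesis by (simp add: cmod_def power2_eq_square)
  qed
  have injG: "inj_on G S'"
    using inj unfolding G_def S'_def inj_on_def by (metis TU UT comp_apply vimageE)
  have contdet: "continuous_on S (\<lambda>w. (cmod (deriv g w))\<^sup>2 * f (g w))"
    by (intro continuous_intros holomorphic_on_imp_continuous_on holomorphic_deriv g S
        continuous_on_compose2[OF cont]) auto
  have "(\<integral>\<^sup>+x\<in>G ` S'. f (T x) \<partial>lborel) =
        (\<integral>\<^sup>+x\<in>S'. \<bar>det (matrix (G' x))\<bar> * f (T (G x)) \<partial>lborel)"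
  proof (rule nn_integral_change_of_variables)
    show "set_borel_measurable borel (G ` S') (\<lambda>x. f (T x))"
      unfolding im by (intro set_measurable_continuous_on open_vimage borel_open opengS
          contT continuous_on_compose2[OF cont]) auto
    show "set_borel_measurable borel S' (\<lambda>x. \<bar>det (matrix (G' x))\<bar> * f (T (G x)))"
      unfolding det using continuous_on_compose2[OF contdet contT, of S']
      by (intro set_measurable_continuous_on borel_open openS')
        (auto simp: S'_def G_def)
  qed (use der injG openS' nonneg im in \<open>auto\<close>)
  moreover have "(\<integral>\<^sup>+z\<in>g ` S. f z \<partial>lborel) = (\<integral>\<^sup>+x\<in>G ` S'. f (T x) \<partial>lborel)"
  proof -
    have [measurable]: "(\<lambda>z. ennreal (f z) * indicator (g ` S) z) \<in> borel_measurable borel"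
    proof -
      have "(\<lambda>z. ennreal (indicator (g ` S) z *\<^sub>R f z)) \<in> borel_measurable borel"
        using set_measurable_continuous_on[OF borel_open[OF opengS] cont]
        unfolding set_borel_measurable_def by simp
      then show ?thesis by (rule measurable_cong[THEN iffD1, rotated]) (auto simp: indicator_def)
    qed
    have "(\<integral>\<^sup>+z\<in>g ` S. f z \<partial>lborel) = (\<integral>\<^sup>+x. ennreal (f (T x)) * indicator (g ` S) (T x) \<partial>lborel)"
      by (subst lb, rule nn_integral_distr) measurable
    also have "\<dots> = (\<integral>\<^sup>+x\<in>G ` S'. f (T x) \<partial>lborel)"
      by (intro nn_integral_cong) (auto simp: im indicator_def)
    finally show ?thesis .
  qed
  moreover have "(\<integral>\<^sup>+w\<in>S. (cmod (deriv g w))\<^sup>2 * f (g w) \<partial>lborel) =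
      (\<integral>\<^sup>+x\<in>S'. \<bar>det (matrix (G' x))\<bar> * f (T (G x)) \<partial>lborel)"
  proof -
    have [measurable]: "(\<lambda>z. ennreal ((cmod (deriv g z))\<^sup>2 * f (g z)) * indicator S z) \<in> borel_measurable borel"
    proof -
      have "(\<lambda>z. ennreal (indicator S z *\<^sub>R ((cmod (deriv g z))\<^sup>2 * f (g z)))) \<in> borel_measurable borel"
        using set_measurable_continuous_on[OF borel_open[OF S] contdet]
        unfolding set_borel_measurable_def by simp
      then show ?thesis by (rule measurable_cong[THEN iffD1, rotated]) (auto simp: indicator_def)
    qed
    have "(\<integral>\<^sup>+w\<in>S. (cmod (deriv g w))\<^sup>2 * f (g w) \<partial>lborel) =
        (\<integral>\<^sup>+x. ennreal ((cmod (deriv g (T x)))\<^sup>2 * f (g (T x))) * indicator S (T x) \<partial>lborel)"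
      by (subst lb, rule nn_integral_distr) measurable
    also have "\<dots> = (\<integral>\<^sup>+x\<in>S'. \<bar>det (matrix (G' x))\<bar> * f (T (G x)) \<partial>lborel)"
      by (intro nn_integral_cong) (auto simp: det G_def S'_def indicator_def)
    finally show ?thesis .
  qed
  ultimately show ?thesis by simp
qed

section \<open>Orthogonality of monomials and Parseval's identity on the disc\<close>

lemma lborel_distr_rotation:
  assumes "cmod \<zeta> = 1"
  shows "distr lborel borel ((*) \<zeta>) = (lborel :: complex measure)"
proof (rule lborel_eqI[symmetric])
  have \<zeta>: "\<zeta> \<noteq> 0" using assms by auto
  fix l u :: complex
  assume le: "\<And>b. b \<in> Basis \<Longrightarrow> l \<bullet> b \<le> u \<bullet> b"
  define V where "V = (*) \<zeta> -` box l u"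
  have "open V"
    unfolding V_def by (intro open_vimage continuous_intros) auto
  have im: "(*) \<zeta> ` V = box l u"
  proof -
    have "surj ((*) \<zeta>)" using \<zeta> by (intro surjI[of _ "\<lambda>z. z / \<zeta>"]) simp
    then show ?thesis unfolding V_def by (rule surj_image_vimage_eq)
  qed
  have d: "deriv ((*) \<zeta>) w = \<zeta>" for w
    by (rule DERIV_imp_deriv) (auto intro!: derivative_eq_intros)
  have "(\<integral>\<^sup>+z\<in>(*) \<zeta> ` V. ennreal 1 \<partial>lborel) =
        (\<integral>\<^sup>+w\<in>V. ennreal ((cmod (deriv ((*) \<zeta>) w))\<^sup>2 * 1) \<partial>lborel)"
    using \<zeta> by (intro nn_integral_holomorphic_change_of_variables \<open>open V\<close> holomorphic_intros)
      (auto simp: inj_on_def)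
  then have "emeasure lborel (box l u) = emeasure lborel V"
    using \<open>open V\<close> unfolding im d assms by simp
  then show "emeasure (distr lborel borel ((*) \<zeta>)) (box l u) = (\<Prod>b\<in>Basis. (u - l) \<bullet> b)"
    using le by (simp add: emeasure_distr V_def emeasure_lborel_box_eq)
qed simp

text \<open>
  Rotating by an angle \<open>x\<close> multiplies the integrand by \<open>cis ((m - n) x)\<close> and preserves the
  integral. The choice \<open>x = \<pi> / (m - n)\<close> makes this factor \<open>-1\<close>.
\<close>
lemma monomials_orthogonal_radial_weight:
  fixes \<rho> :: "real \<Rightarrow> real"
  assumes [measurable]: "\<rho> \<in> borel_measurable borel" and "m \<noteq> n"
  shows "(LINT w|lborel. of_real (\<rho> (cmod w)) * (w ^ m * cnj w ^ n)) = 0"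
proof -
  let ?h = "\<lambda>w. of_real (\<rho> (cmod w)) * (w ^ m * cnj w ^ n)"
  define x where "x = pi / (real m - real n)"
  have x: "real m * x - real n * x = pi"
    using \<open>m \<noteq> n\<close> by (simp add: x_def divide_simps flip: left_diff_distrib)
  define \<zeta> where "\<zeta> = cis x"
  have *: "\<zeta> ^ m * cnj \<zeta> ^ n = -1"
  proof -
    have "cis (real m * x) * cis (- (real n * x)) = cis pi"
      using x by (simp add: cis_mult)
    then show ?thesis by (simp only: \<zeta>_def cis_cnj Complex.DeMoivre mult_minus_right cis_pi)
  qed
  have [measurable]: "cnj \<in> borel_measurable borel"
    by (intro borel_measurable_continuous_onI continuous_intros)
  have "?h (\<zeta> * w) = - ?h w" for w
  proof -
    have "?h (\<zeta> * w) = of_real (\<rho> (cmod w)) * ((\<zeta> ^ m * cnj \<zeta> ^ n) * (w ^ m * cnj w ^ n))"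
      by (simp add: power_mult_distrib norm_mult mult_ac) (simp add: \<zeta>_def)
    then show ?thesis unfolding * by simp
  qed
  moreover have "(LINT w|lborel. ?h w) = (LINT w|lborel. ?h (\<zeta> * w))"
    by (subst (1) lborel_distr_rotation[of \<zeta>, symmetric]) (simp_all add: \<zeta>_def integral_distr)
  ultimately show ?thesis by simp
qed

lemma Parseval_polynomial_cball:
  fixes \<rho> :: "real \<Rightarrow> real" and c :: "nat \<Rightarrow> complex"
  assumes \<rho>: "continuous_on UNIV \<rho>"
  shows "(LINT w:cball 0 r|lborel. (cmod (\<Sum>n<N. c n * w ^ n))\<^sup>2 * \<rho> (cmod w)) =
         (\<Sum>n<N. (cmod (c n))\<^sup>2 * (LINT w:cball 0 r|lborel. cmod w ^ (2 * n) * \<rho> (cmod w)))"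
proof -
  \<comment> \<open>The disc is absorbed into the radial weight.\<close>
  define \<sigma> where "\<sigma> t = indicator {..r} t * \<rho> t" for t
  have [measurable]: "\<rho> \<in> borel_measurable borel"
    using \<rho> by (rule borel_measurable_continuous_onI)
  have [measurable]: "\<sigma> \<in> borel_measurable borel" unfolding \<sigma>_def by measurable
  have ind: "indicator (cball 0 r) w *\<^sub>R (a * \<rho> (cmod w)) = \<sigma> (cmod w) * a" for a and w :: complex
    by (simp add: \<sigma>_def indicator_def)
  have int: "integrable lborel (\<lambda>w. of_real (\<sigma> (cmod w)) * (w ^ m * cnj w ^ n))" for m n
  proof -
    have "integrable lborel (\<lambda>w. indicator (cball 0 r) w *\<^sub>R (of_real (\<rho> (cmod w)) * (w ^ m * cnj w ^ n)))"
      by (intro borel_integrable_compact compact_cball continuous_intros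
          continuous_on_compose2[OF \<rho>]) auto
    then show ?thesis by (rule back_subst[of "integrable lborel"]) (auto simp: \<sigma>_def indicator_def)
  qed
  let ?I = "\<lambda>m n. (LINT w|lborel. of_real (\<sigma> (cmod w)) * (w ^ m * cnj w ^ n))"
  have "complex_of_real (LINT w:cball 0 r|lborel. (cmod (\<Sum>n<N. c n * w ^ n))\<^sup>2 * \<rho> (cmod w)) =
        (LINT w|lborel. of_real (\<sigma> (cmod w) * (cmod (\<Sum>n<N. c n * w ^ n))\<^sup>2))"
    unfolding set_lebesgue_integral_def ind by (rule integral_complex_of_real[symmetric])
  also have "\<dots> = (LINT w|lborel. (\<Sum>m<N. \<Sum>n<N. (c m * cnj (c n)) * (of_real (\<sigma> (cmod w)) * (w ^ m * cnj w ^ n))))"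
  proof (rule Bochner_Integration.integral_cong[OF refl])
    fix w :: complex
    show "complex_of_real (\<sigma> (cmod w) * (cmod (\<Sum>n<N. c n * w ^ n))\<^sup>2) =
      (\<Sum>m<N. \<Sum>n<N. (c m * cnj (c n)) * (of_real (\<sigma> (cmod w)) * (w ^ m * cnj w ^ n)))"
    proof -
      have "complex_of_real ((cmod (\<Sum>n<N. c n * w ^ n))\<^sup>2) =
          (\<Sum>m<N. c m * w ^ m) * (\<Sum>n<N. cnj (c n) * cnj w ^ n)"
        by (simp add: complex_norm_square del: of_real_power)
      then show ?thesis
        unfolding of_real_mult
        by (simp only: sum_product sum_distrib_left mult_ac) (rule sum.swap)
    qed
  qed
  also have "\<dots> = (\<Sum>m<N. \<Sum>n<N. (c m * cnj (c n)) * ?I m n)"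
    using int by (simp add: Bochner_Integration.integral_sum)
  also have "\<dots> = (\<Sum>m<N. \<Sum>n<N. if n = m then (c m * cnj (c n)) * ?I m n else 0)"
    by (intro sum.cong) (auto simp: monomials_orthogonal_radial_weight)
  also have "\<dots> = (\<Sum>m<N. (c m * cnj (c m)) * ?I m m)"
    by (simp add: sum.delta)
  also have "\<dots> = (\<Sum>m<N. complex_of_real ((cmod (c m))\<^sup>2 * (LINT w:cball 0 r|lborel. cmod w ^ (2 * m) * \<rho> (cmod w))))"
  proof (rule sum.cong[OF refl])
    fix m
    have pow: "w ^ m * cnj w ^ m = complex_of_real (cmod w ^ (2 * m))" for w
      by (metis complex_norm_square of_real_power power_mult power_mult_distrib)
    have "?I m m = (LINT w|lborel. of_real (\<sigma> (cmod w) * cmod w ^ (2 * m)))"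
      by (intro Bochner_Integration.integral_cong[OF refl])
        (simp only: pow of_real_mult)
    also have "\<dots> = of_real (LINT w:cball 0 r|lborel. cmod w ^ (2 * m) * \<rho> (cmod w))"
      unfolding set_lebesgue_integral_def ind by (rule integral_complex_of_real)
    finally show "(c m * cnj (c m)) * ?I m m =
      complex_of_real ((cmod (c m))\<^sup>2 * (LINT w:cball 0 r|lborel. cmod w ^ (2 * m) * \<rho> (cmod w)))"
      by (simp add: complex_norm_square del: of_real_power)
  qed
  finally show ?thesis by (simp only: of_real_sum[symmetric] of_real_eq_iff)
qed

text \<open>
  The partial sums are bounded on the closed disc by \<open>\<Sum> |c\<^sub>n| r\<^sup>n\<close>, which is finite because \<open>r < 1\<close>,
  so the polynomial case passes to the limit by dominated convergence.
\<close>
lemma Parseval_power_series_cball: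
  fixes \<rho> :: "real \<Rightarrow> real" and c :: "nat \<Rightarrow> complex"
  assumes \<rho>: "continuous_on UNIV \<rho>"
    and h: "\<And>w. cmod w < 1 \<Longrightarrow> (\<lambda>n. c n * w ^ n) sums h w"
    and r: "0 \<le> r" "r < 1"
  shows "(\<lambda>n. (cmod (c n))\<^sup>2 * (LINT w:cball 0 r|lborel. cmod w ^ (2 * n) * \<rho> (cmod w))) sums
         (LINT w:cball 0 r|lborel. (cmod (h w))\<^sup>2 * \<rho> (cmod w))"
proof -
  let ?s = "\<lambda>N w. indicator (cball 0 r) w *\<^sub>R ((cmod (\<Sum>n<N. c n * w ^ n))\<^sup>2 * \<rho> (cmod w))"
  let ?l = "\<lambda>w. indicator (cball 0 r) w *\<^sub>R ((cmod (h w))\<^sup>2 * \<rho> (cmod w))"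
  obtain R where R: "r < R" "R < 1" using r dense by blast
  have "summable (\<lambda>n. c n * complex_of_real R ^ n)"
    using h[of "of_real R"] R r by (auto simp: sums_iff)
  then have summ: "summable (\<lambda>n. cmod (c n * of_real r ^ n))"
    by (rule powser_insidea) (use R r in auto)
  define B where "B = (\<Sum>n. cmod (c n * of_real r ^ n))"
  have bound: "cmod (\<Sum>n<N. c n * w ^ n) \<le> B" if "cmod w \<le> r" for N w
  proof -
    have "cmod (\<Sum>n<N. c n * w ^ n) \<le> (\<Sum>n<N. cmod (c n * of_real r ^ n))"
      using that r by (intro sum_norm_le) (auto simp: norm_mult norm_power intro!: mult_left_mono power_mono)
    also have "\<dots> \<le> B" unfolding B_def by (rule sum_le_suminf[OF summ]) auto
    finally show ?thesis .
  qed
  have pw: "(\<lambda>N. ?s N w) \<longlonglongrightarrow> ?l w" for w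
  proof (cases "cmod w \<le> r")
    case True
    then have "(\<lambda>N. \<Sum>n<N. c n * w ^ n) \<longlonglongrightarrow> h w"
      using h[of w] r unfolding sums_def by auto
    then show ?thesis by (intro tendsto_intros)
  qed simp
  have meas: "?s N \<in> borel_measurable lborel" for N
  proof -
    have "?s N \<in> borel_measurable borel"
      by (intro borel_measurable_continuous_on_indicator continuous_intros
          continuous_on_compose2[OF \<rho>]) auto
    then show ?thesis by simp
  qed
  have "(\<lambda>N. LINT w|lborel. ?s N w) \<longlonglongrightarrow> (LINT w|lborel. ?l w)"
  proof (rule integral_dominated_convergence[where w = "\<lambda>w. indicator (cball 0 r) w *\<^sub>R (B\<^sup>2 * \<bar>\<rho> (cmod w)\<bar>)"])
    show "?l \<in> borel_measurable lborel"
      using meas pw by (rule borel_measurable_LIMSEQ_real[rotated])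
    show "integrable lborel (\<lambda>w::complex. indicator (cball 0 r) w *\<^sub>R (B\<^sup>2 * \<bar>\<rho> (cmod w)\<bar>))"
      by (intro borel_integrable_compact compact_cball continuous_intros
          continuous_on_compose2[OF \<rho>]) auto
    show "AE w in lborel. norm (?s N w) \<le> indicator (cball 0 r) w *\<^sub>R (B\<^sup>2 * \<bar>\<rho> (cmod w)\<bar>)" for N
      using bound by (intro AE_I2) (auto simp: indicator_def abs_mult intro!: mult_right_mono power_mono)
  qed (use meas pw in auto)
  then show ?thesis
    using Parseval_polynomial_cball[OF \<rho>, of r c]
    unfolding sums_def set_lebesgue_integral_def by simp
qed

lemma nn_integral_unit_ball_SUP_cball:
  fixes f :: "'a::euclidean_space \<Rightarrow> ennreal"
  assumes [measurable]: "f \<in> borel_measurable borel"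
  shows "(\<integral>\<^sup>+w\<in>ball 0 1. f w \<partial>lborel) =
         (SUP k. \<integral>\<^sup>+w\<in>cball 0 (1 - 1 / real (Suc k)). f w \<partial>lborel)"
proof -
  let ?r = "\<lambda>k. 1 - 1 / real (Suc k)"
  have r_mono: "?r j \<le> ?r k" if "j \<le> k" for j k
    using that by (simp add: frac_le)
  have [measurable]: "cball (0 :: 'a) (?r k) \<in> sets borel" for k by simp
  have "(SUP k. f w * indicator (cball 0 (?r k)) w) = f w * indicator (ball 0 1) w" for w
  proof (cases "norm w < 1")
    case True
    then obtain k where "norm w < ?r k"
      using reals_Archimedean[of "1 - norm w"] by (auto simp: inverse_eq_divide algebra_simps)
    then have "f w \<le> (SUP k. f w * indicator (cball 0 (?r k)) w)"
      by (intro SUP_upper2[of k]) auto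
    moreover have "(SUP k. f w * indicator (cball 0 (?r k)) w) \<le> f w"
      by (intro SUP_least) (auto simp: indicator_def)
    ultimately show ?thesis using True by simp
  next
    case False
    then have "\<not> norm w \<le> ?r k" for k
      by (smt (verit) divide_pos_pos of_nat_0_less_iff zero_less_Suc)
    then show ?thesis using False by simp
  qed
  then have "(\<integral>\<^sup>+w\<in>ball 0 1. f w \<partial>lborel) =
      (\<integral>\<^sup>+w. (SUP k. f w * indicator (cball 0 (?r k)) w) \<partial>lborel)" by simp
  also have "\<dots> = (SUP k. \<integral>\<^sup>+w\<in>cball 0 (?r k). f w \<partial>lborel)"
  proof (rule nn_integral_monotone_convergence_SUP)
    show "incseq (\<lambda>k w. f w * indicator (cball 0 (?r k)) w)"
      using r_mono by (intro monoI le_funI mult_left_mono) (auto simp: indicator_def intro: order_trans)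
  qed measurable
  finally show ?thesis .
qed

text \<open>
  Both sides are suprema over the closed discs of radius \<open>1 - 1/(k+1)\<close>; on each of these
  the identity is an equality of finite numbers, and the limits are monotone, so it survives with
  values in the extended nonnegative reals.
\<close>
theorem Parseval_unit_disc:
  fixes \<rho> :: "real \<Rightarrow> real" and c :: "nat \<Rightarrow> complex"
  assumes \<rho>: "continuous_on UNIV \<rho>" "\<And>t. 0 \<le> t \<Longrightarrow> t \<le> 1 \<Longrightarrow> 0 \<le> \<rho> t"
    and h: "\<And>w. cmod w < 1 \<Longrightarrow> (\<lambda>n. c n * w ^ n) sums h w"
  shows "(\<integral>\<^sup>+w\<in>ball 0 1. ennreal ((cmod (h w))\<^sup>2 * \<rho> (cmod w)) \<partial>lborel) =
         (\<Sum>n. ennreal ((cmod (c n))\<^sup>2) *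
            (\<integral>\<^sup>+w\<in>ball (0::complex) 1. ennreal (cmod w ^ (2 * n) * \<rho> (cmod w)) \<partial>lborel))"
proof -
  let ?r = "\<lambda>k. 1 - 1 / real (Suc k)"
  have r: "0 \<le> ?r k" "?r k < 1" for k by auto
  have r_mono: "?r j \<le> ?r k" if "j \<le> k" for j k
    using that by (simp add: frac_le)
  have cball_sub: "cball 0 (?r k) \<subseteq> ball (0::complex) 1" for k
    using r[of k] by (simp only: cball_subset_ball_iff dist_self) simp
  have "h holomorphic_on ball 0 1"
    using h by (intro power_series_holomorphic[where a = c]) auto
  then have conth: "continuous_on (ball 0 1) h"
    by (rule holomorphic_on_imp_continuous_on)
  \<comment> \<open>On a smaller closed disc the integrand is continuous, so both integrals agree.\<close>
  have cball: "(\<integral>\<^sup>+w\<in>cball 0 (?r k). ennreal ((cmod (u w))\<^sup>2 * \<rho> (cmod w)) \<partial>lborel) =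
      ennreal (LINT w:cball 0 (?r k)|lborel. (cmod (u w))\<^sup>2 * \<rho> (cmod w))" (is ?A)
    "0 \<le> (LINT w:cball 0 (?r k)|lborel. (cmod (u w))\<^sup>2 * \<rho> (cmod w))" (is ?B)
    if u: "continuous_on (ball 0 1) u" for k and u :: "complex \<Rightarrow> complex"
  proof -
    let ?g = "\<lambda>w. indicator (cball 0 (?r k)) w *\<^sub>R ((cmod (u w))\<^sup>2 * \<rho> (cmod w))"
    have "continuous_on (cball 0 (?r k)) u"
      using u cball_sub by (rule continuous_on_subset)
    then have int: "integrable lborel ?g"
      by (intro borel_integrable_compact compact_cball continuous_intros
          continuous_on_compose2[OF \<rho>(1)]) auto
    have nonneg: "0 \<le> ?g w" for w
    proof (cases "w \<in> cball 0 (?r k)")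
      case True
      then have "cmod w \<le> 1" using cball_sub by fastforce
      then show ?thesis using \<rho>(2)[of "cmod w"] by (simp add: indicator_def)
    qed simp
    have "(\<integral>\<^sup>+w. ennreal (?g w) \<partial>lborel) = ennreal (LINT w|lborel. ?g w)"
      using int nonneg by (intro nn_integral_eq_integral) auto
    moreover have "(\<integral>\<^sup>+w\<in>cball 0 (?r k). ennreal ((cmod (u w))\<^sup>2 * \<rho> (cmod w)) \<partial>lborel) =
        (\<integral>\<^sup>+w. ennreal (?g w) \<partial>lborel)"
      by (intro nn_integral_cong) (auto simp: indicator_def)
    ultimately show ?A ?B
      using nonneg by (simp_all add: set_lebesgue_integral_def Bochner_Integration.integral_nonneg)
  qed
  have ball: "(\<integral>\<^sup>+w\<in>ball 0 1. ennreal ((cmod (u w))\<^sup>2 * \<rho> (cmod w)) \<partial>lborel) =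
      (SUP k. \<integral>\<^sup>+w\<in>cball 0 (?r k). ennreal ((cmod (u w))\<^sup>2 * \<rho> (cmod w)) \<partial>lborel)"
    if u: "continuous_on (ball 0 1) u" for u :: "complex \<Rightarrow> complex"
  proof -
    have "(\<lambda>w. ennreal (indicator (ball 0 1) w *\<^sub>R ((cmod (u w))\<^sup>2 * \<rho> (cmod w)))) \<in> borel_measurable borel"
      by (intro measurable_compose[OF _ measurable_ennreal] borel_measurable_continuous_on_indicator
          continuous_intros continuous_on_compose2[OF \<rho>(1)] u) auto
    from nn_integral_unit_ball_SUP_cball[OF this] 
    have "(\<integral>\<^sup>+w\<in>ball 0 1. ennreal (indicator (ball 0 1) w *\<^sub>R ((cmod (u w))\<^sup>2 * \<rho> (cmod w))) \<partial>lborel) =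
      (SUP k. \<integral>\<^sup>+w\<in>cball 0 (?r k). ennreal (indicator (ball 0 1) w *\<^sub>R ((cmod (u w))\<^sup>2 * \<rho> (cmod w))) \<partial>lborel)" .
    moreover have "ennreal (indicator (ball 0 1) w *\<^sub>R ((cmod (u w))\<^sup>2 * \<rho> (cmod w))) * indicator (ball 0 1) w
      = ennreal ((cmod (u w))\<^sup>2 * \<rho> (cmod w)) * indicator (ball 0 1) w" for w
      by (auto simp: indicator_def)
    moreover have "ennreal (indicator (ball 0 1) w *\<^sub>R ((cmod (u w))\<^sup>2 * \<rho> (cmod w))) * indicator (cball 0 (?r k)) w
      = ennreal ((cmod (u w))\<^sup>2 * \<rho> (cmod w)) * indicator (cball 0 (?r k)) w" for k w
      using cball_sub[of k] by (auto simp: indicator_def subset_iff)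
    ultimately show ?thesis by simp
  qed
  have contp: "continuous_on (ball 0 1) (\<lambda>w::complex. w ^ n)" for n
    by (intro continuous_intros)
  let ?M = "\<lambda>k n. \<integral>\<^sup>+w\<in>cball (0::complex) (?r k). ennreal ((cmod (w ^ n))\<^sup>2 * \<rho> (cmod w)) \<partial>lborel"
  let ?m = "\<lambda>k n. LINT w:cball (0::complex) (?r k)|lborel. (cmod (w ^ n))\<^sup>2 * \<rho> (cmod w)"
  have pow: "cmod w ^ (2 * n) = (cmod (w ^ n))\<^sup>2" for w :: complex and n
    by (simp add: norm_power power_mult mult.commute flip: power_mult)
  have "(\<integral>\<^sup>+w\<in>ball 0 1. ennreal ((cmod (h w))\<^sup>2 * \<rho> (cmod w)) \<partial>lborel) =
      (SUP k. \<Sum>n. ennreal ((cmod (c n))\<^sup>2) * ?M k n)"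
    unfolding ball[OF conth]
  proof (intro SUP_cong refl)
    fix k
    have S: "(\<lambda>n. (cmod (c n))\<^sup>2 * ?m k n) sums (LINT w:cball 0 (?r k)|lborel. (cmod (h w))\<^sup>2 * \<rho> (cmod w))"
      using Parseval_power_series_cball[OF \<rho>(1) h r[of k]] unfolding pow by simp
    have "(\<Sum>n. ennreal ((cmod (c n))\<^sup>2) * ?M k n) = (\<Sum>n. ennreal ((cmod (c n))\<^sup>2 * ?m k n))"
      unfolding cball(1)[OF contp] using cball(2)[OF contp] by (simp add: ennreal_mult)
    also have "\<dots> = ennreal (\<Sum>n. (cmod (c n))\<^sup>2 * ?m k n)"
      using S cball(2)[OF contp] by (intro suminf_ennreal2) (auto simp: sums_iff)
    also have "\<dots> = (\<integral>\<^sup>+w\<in>cball 0 (?r k). ennreal ((cmod (h w))\<^sup>2 * \<rho> (cmod w)) \<partial>lborel)"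
      unfolding cball(1)[OF conth] using S by (simp add: sums_iff)
    finally show "(\<integral>\<^sup>+w\<in>cball 0 (?r k). ennreal ((cmod (h w))\<^sup>2 * \<rho> (cmod w)) \<partial>lborel) =
      (\<Sum>n. ennreal ((cmod (c n))\<^sup>2) * ?M k n)" ..
  qed
  also have "\<dots> = (\<Sum>n. SUP k. ennreal ((cmod (c n))\<^sup>2) * ?M k n)"
  proof (rule ennreal_suminf_SUP_eq[symmetric], rule incseq_SucI)
    fix n k
    show "ennreal ((cmod (c n))\<^sup>2) * ?M k n \<le> ennreal ((cmod (c n))\<^sup>2) * ?M (Suc k) n"
      using r_mono[of k "Suc k"]
      by (intro mult_left_mono nn_integral_mono) (auto simp: indicator_def)
  qed
  also have "\<dots> = (\<Sum>n. ennreal ((cmod (c n))\<^sup>2) * (SUP k. ?M k n))"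
    by (simp add: SUP_mult_left_ennreal)
  finally show ?thesis
    unfolding pow ball[OF contp] .
qed

section \<open>Moments of the unit disc\<close>

text \<open>
  Layer cake: \<open>|w| ^ (2 n)\<close> is the integral of \<open>2 n s ^ (2 n - 1)\<close> over \<open>0 \<le> s \<le> |w|\<close>, and after
  exchanging the integrals the annulus \<open>s \<le> |w| < 1\<close> contributes its area \<open>\<pi> - \<pi> s\<^sup>2\<close>. This replaces
  polar coordinates.
\<close>
lemma nn_integral_unit_disc_even_power:
  "(\<integral>\<^sup>+w\<in>ball (0::complex) 1. ennreal (cmod w ^ (2 * n)) \<partial>lborel) = ennreal (pi / (n + 1))"
proof (cases n)
  case 0
  then show ?thesis by (simp add: emeasure_ball unit_ball_vol_2)
next
  case (Suc m)
  let ?d = "\<lambda>s::real. 2 * real n * s ^ (2 * m + 1)"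
  have FTC: "(\<integral>\<^sup>+s. ennreal (?d s) * indicator {0..x} s \<partial>lborel) = ennreal (x ^ (2 * n))" if "0 \<le> x" for x
  proof -
    have "((\<lambda>x. x ^ (2 * n)) has_real_derivative ?d s) (at s)" for s
      using Suc by (intro derivative_eq_intros refl | simp)+
    then have "(\<integral>\<^sup>+s. ennreal (?d s) * indicator {0..x} s \<partial>lborel) = ennreal (x ^ (2 * n) - 0 ^ (2 * n))"
      using that by (intro nn_integral_FTC_Icc) auto
    then show ?thesis using Suc by simp
  qed
  have "(\<integral>\<^sup>+w\<in>ball (0::complex) 1. ennreal (cmod w ^ (2 * n)) \<partial>lborel) =
    (\<integral>\<^sup>+w. (\<integral>\<^sup>+s. ennreal (?d s) * (if 0 \<le> s \<and> s \<le> cmod w \<and> cmod w < 1 then 1 else 0) \<partial>lborel) \<partial>lborel)"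
  proof (rule nn_integral_cong)
    fix w :: complex
    have "(\<integral>\<^sup>+s. ennreal (?d s) * (if 0 \<le> s \<and> s \<le> cmod w \<and> cmod w < 1 then 1 else 0) \<partial>lborel) =
      (\<integral>\<^sup>+s. (ennreal (?d s) * indicator {0..cmod w} s) * indicator (ball 0 1) w \<partial>lborel)"
      by (intro nn_integral_cong) (auto simp: indicator_def)
    also have "\<dots> = ennreal (cmod w ^ (2 * n)) * indicator (ball 0 1) w"
      by (subst nn_integral_multc) (measurable, simp only: FTC[OF norm_ge_zero])
    finally show "ennreal (cmod w ^ (2 * n)) * indicator (ball 0 1) w =
      (\<integral>\<^sup>+s. ennreal (?d s) * (if 0 \<le> s \<and> s \<le> cmod w \<and> cmod w < 1 then 1 else 0) \<partial>lborel)" ..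
  qed
  also have "\<dots> = (\<integral>\<^sup>+s. (\<integral>\<^sup>+w. ennreal (?d s) * (if 0 \<le> s \<and> s \<le> cmod w \<and> cmod w < 1 then 1 else 0) \<partial>lborel) \<partial>lborel)"
    by (rule lborel_pair.Fubini'[symmetric]) measurable
  also have "\<dots> = (\<integral>\<^sup>+s. ennreal (2 * real n * pi * (s ^ (2 * m + 1) - s ^ (2 * m + 3))) * indicator {0..1} s \<partial>lborel)"
  proof (rule nn_integral_cong)
    fix s :: real
    show "(\<integral>\<^sup>+w. ennreal (?d s) * (if 0 \<le> s \<and> s \<le> cmod w \<and> cmod w < 1 then 1 else 0) \<partial>lborel) =
      ennreal (2 * real n * pi * (s ^ (2 * m + 1) - s ^ (2 * m + 3))) * indicator {0..1} s"
    proof (cases "0 \<le> s \<and> s \<le> 1")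
      case True
      have "(\<integral>\<^sup>+w. ennreal (?d s) * (if 0 \<le> s \<and> s \<le> cmod w \<and> cmod w < 1 then 1 else 0) \<partial>lborel) =
        (\<integral>\<^sup>+w. ennreal (?d s) * indicator (ball (0::complex) 1 - ball 0 s) w \<partial>lborel)"
        using True by (intro nn_integral_cong) (auto simp: indicator_def)
      also have "\<dots> = ennreal (?d s) * emeasure lborel (ball (0::complex) 1 - ball 0 s)"
        by (rule nn_integral_cmult_indicator) simp
      also have "emeasure lborel (ball (0::complex) 1 - ball 0 s) = ennreal (pi - pi * s\<^sup>2)"
        using True by (subst emeasure_Diff) (auto simp: emeasure_ball unit_ball_vol_2 ennreal_minus)
      also have "ennreal (?d s) * \<dots> = ennreal (2 * real n * pi * (s ^ (2 * m + 1) - s ^ (2 * m + 3)))"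
        using True by (subst ennreal_mult'[symmetric])
          (simp_all add: algebra_simps power_add power2_eq_square power3_eq_cube)
      finally show ?thesis using True by simp
    next
      case False
      then have *: "(0 \<le> s \<and> s \<le> cmod w \<and> cmod w < 1) = False" for w :: complex by auto
      show ?thesis
        unfolding * if_False using False by (auto simp: indicator_def)
    qed
  qed
  also have "\<dots> = ennreal (pi - pi * real n / real (n + 1))"
  proof -
    let ?F = "\<lambda>s::real. pi * s ^ (2 * m + 2) - pi * real n / real (n + 1) * s ^ (2 * m + 4)"
    have "(\<integral>\<^sup>+s. ennreal (2 * real n * pi * (s ^ (2 * m + 1) - s ^ (2 * m + 3))) * indicator {0..1} s \<partial>lborel) =
      ennreal (?F 1 - ?F 0)"
    proof (rule nn_integral_FTC_Icc)
      fix s :: real assume s: "s \<in> {0..1}"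
      show "(?F has_real_derivative 2 * real n * pi * (s ^ (2 * m + 1) - s ^ (2 * m + 3))) (at s)"
      proof -
        have "(?F has_real_derivative (pi * (real (2 * m + 2) * s ^ (2 * m + 2 - Suc 0)) -
            pi * real n / real (n + 1) * (real (2 * m + 4) * s ^ (2 * m + 4 - Suc 0)))) (at s)"
          by (intro DERIV_diff DERIV_cmult DERIV_pow)
        moreover have "pi * (real (2 * m + 2) * s ^ (2 * m + 2 - Suc 0)) = 2 * real n * pi * s ^ (2 * m + 1)"
          using Suc by simp
        moreover have "pi * real n / real (n + 1) * (real (2 * m + 4) * s ^ (2 * m + 4 - Suc 0)) = 2 * real n * pi * s ^ (2 * m + 3)"
        proof -
          have *: "real (2 * m + 4) = 2 * real (n + 1)" "2 * m + 4 - Suc 0 = 2 * m + 3" using Suc by auto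
          have cancel: "pi * x / y * (2 * y * t) = 2 * x * pi * t" if "y \<noteq> 0" for x y t :: real
            using that by simp
          show ?thesis unfolding * by (rule cancel) simp
        qed
        ultimately show ?thesis by (simp only: right_diff_distrib)
      qed
      show "0 \<le> 2 * real n * pi * (s ^ (2 * m + 1) - s ^ (2 * m + 3))"
        using s power_decreasing[of "2 * m + 1" "2 * m + 3" s] by simp
    qed auto
    then show ?thesis by (simp add: zero_power)
  qed
  also have "pi - pi * real n / real (n + 1) = pi / (n + 1)" by (simp add: field_simps)
  finally show ?thesis .
qed

text \<open>
  Expanding the weight gives the second difference \<open>\<pi>/(n+1) - 2 \<pi>/(n+2) + \<pi>/(n+3)\<close> of the moments.
\<close>
lemma nn_integral_unit_disc_even_power_weighted:
  "(\<integral>\<^sup>+w\<in>ball (0::complex) 1. ennreal (cmod w ^ (2 * n) * (1 - (cmod w)\<^sup>2)\<^sup>2) \<partial>lborel) =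
   ennreal (2 * pi / ((real n + 1) * (real n + 2) * (real n + 3)))"
proof -
  have *: "has_bochner_integral lborel (\<lambda>w::complex. cmod w ^ (2 * k) * indicator (ball 0 1) w) (pi / (k + 1))" for k
  proof (rule has_bochner_integral_nn_integral)
    show "(\<integral>\<^sup>+w. ennreal (cmod w ^ (2 * k) * indicator (ball 0 1) w) \<partial>lborel) = ennreal (pi / (k + 1))"
      unfolding nn_integral_unit_disc_even_power[symmetric]
      by (intro nn_integral_cong) (auto simp: indicator_def)
  qed (auto simp: indicator_def)
  have "has_bochner_integral lborel (\<lambda>w::complex. cmod w ^ (2 * n) * indicator (ball 0 1) w
       - 2 * (cmod w ^ (2 * (n + 1)) * indicator (ball 0 1) w) + cmod w ^ (2 * (n + 2)) * indicator (ball 0 1) w)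
    (pi / (n + 1) - 2 * (pi / ((n + 1) + 1)) + pi / ((n + 2) + 1))"
    using *[of n] *[of "n + 1"] *[of "n + 2"]
    by (intro has_bochner_integral_add has_bochner_integral_diff has_bochner_integral_mult_right) (auto simp: add_ac)
  also have "(\<lambda>w::complex. cmod w ^ (2 * n) * indicator (ball 0 1) w
       - 2 * (cmod w ^ (2 * (n + 1)) * indicator (ball 0 1) w) + cmod w ^ (2 * (n + 2)) * indicator (ball 0 1) w) =
     (\<lambda>w. cmod w ^ (2 * n) * (1 - (cmod w)\<^sup>2)\<^sup>2 * indicator (ball 0 1) w)"
    by (auto simp: fun_eq_iff indicator_def power2_eq_square power_add algebra_simps)
  also have "pi / (n + 1) - 2 * (pi / ((n + 1) + 1)) + pi / ((n + 2) + 1) = 2 * pi / ((real n + 1) * (real n + 2) * (real n + 3))"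
  proof -
    define x where "x = real n"
    have "x + 1 \<noteq> 0" "x + 2 \<noteq> 0" "x + 3 \<noteq> 0"
      by (auto simp: x_def add_eq_0_iff)
    then have "pi / (x + 1) - 2 * (pi / (x + 2)) + pi / (x + 3) = 2 * pi / ((x + 1) * (x + 2) * (x + 3))"
      by (simp add: divide_simps) (simp add: algebra_simps)
    then show ?thesis by (simp add: x_def algebra_simps)
  qed
  finally have hb: "has_bochner_integral lborel (\<lambda>w::complex. cmod w ^ (2 * n) * (1 - (cmod w)\<^sup>2)\<^sup>2 * indicator (ball 0 1) w)
     (2 * pi / ((real n + 1) * (real n + 2) * (real n + 3)))" .
  have "(\<integral>\<^sup>+w. ennreal (cmod w ^ (2 * n) * (1 - (cmod w)\<^sup>2)\<^sup>2 * indicator (ball 0 1) w) \<partial>lborel) =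
     ennreal (2 * pi / ((real n + 1) * (real n + 2) * (real n + 3)))"
    using hb by (subst nn_integral_eq_integral) (auto simp: has_bochner_integral_iff)
  then show ?thesis
    by (subst (asm) nn_integral_cong[where v = "\<lambda>w. ennreal (cmod w ^ (2 * n) * (1 - (cmod w)\<^sup>2)\<^sup>2) * indicator (ball 0 1) w"])
      (auto simp: indicator_def)
qed

section \<open>The contractive estimate on the disc\<close>

lemma sum_convolution_Suc_weights:
  "(\<Sum>i\<le>n. real (i + 1) * real (n - i + 1)) = (real n + 1) * (real n + 2) * (real n + 3) / 6"
proof -
  \<comment> \<open>Decoupling the upper limit from \<open>n\<close> makes induction possible.\<close>
  have "(\<Sum>i\<le>m. (real i + 1) * (x - real i + 1)) =
      (x + 2) * (m + 1) * (m + 2) / 2 - (m + 1) * (m + 2) * (2 * m + 3) / 6" for m :: nat and x :: real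
    by (induction m) (auto simp: field_simps)
  from this[where m = n and x = "real n"]
  have "(\<Sum>i\<le>n. (real i + 1) * (real n - real i + 1)) = (real n + 1) * (real n + 2) * (real n + 3) / 6"
    by (simp add: field_simps)
  moreover have "(\<Sum>i\<le>n. real (i + 1) * real (n - i + 1)) = (\<Sum>i\<le>n. (real i + 1) * (real n - real i + 1))"
    by (intro sum.cong) (auto simp: of_nat_diff algebra_simps)
  ultimately show ?thesis by (simp add: algebra_simps)
qed

text \<open>
  Cauchy-Schwarz after multiplying and dividing the \<open>i\<close>-th term by the square root of
  \<open>(i+1)(n-i+1)\<close>. With these weights equality holds for \<open>a\<^sub>i = (i+1) t\<^sup>i\<close>, the coefficients of the
  Bergman kernel.
\<close>
lemma Cauchy_product_coefficient_bound:
  fixes a :: "nat \<Rightarrow> complex"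
  shows "(cmod (\<Sum>i\<le>n. a i * a (n - i)))\<^sup>2 \<le> (real n + 1) * (real n + 2) * (real n + 3) / 6 *
    (\<Sum>i\<le>n. (cmod (a i))\<^sup>2 / (i + 1) * ((cmod (a (n - i)))\<^sup>2 / (n - i + 1)))"
proof -
  define v where "v i = sqrt (real (i + 1) * real (n - i + 1))" for i
  have v: "v i > 0" "(v i)\<^sup>2 = real (i + 1) * real (n - i + 1)" for i
    by (simp_all add: v_def)
  have "(cmod (\<Sum>i\<le>n. a i * a (n - i)))\<^sup>2 \<le> (\<Sum>i\<le>n. cmod (a i) * cmod (a (n - i)))\<^sup>2"
    by (intro power_mono sum_norm_le) (simp_all add: norm_mult)
  also have "(\<Sum>i\<le>n. cmod (a i) * cmod (a (n - i))) = (\<Sum>i\<le>n. v i * (cmod (a i) * cmod (a (n - i)) / v i))"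
    using v(1) by (intro sum.cong) (auto simp: less_le)
  also have "\<dots>\<^sup>2 \<le> (\<Sum>i\<le>n. (v i)\<^sup>2) * (\<Sum>i\<le>n. (cmod (a i) * cmod (a (n - i)) / v i)\<^sup>2)"
    by (rule Cauchy_Schwarz_ineq_sum)
  finally show ?thesis
    by (simp only: power_divide power_mult_distrib v(2) sum_convolution_Suc_weights)
      (simp add: times_divide_times_eq add_ac)
qed

text \<open>
  In the series of \<open>\<integral> |f\<^sup>2|\<^sup>2 (1 - |w|\<^sup>2)\<^sup>2\<close> the moment \<open>2 \<pi> / ((n+1)(n+2)(n+3))\<close> cancels the constant of
  the coefficient bound up to \<open>\<pi>/3\<close>, for every \<open>n\<close>. What remains is the Cauchy product of the
  series for \<open>\<integral> |f|\<^sup>2\<close> with itself.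
\<close>
theorem unit_disc_L4_contraction:
  assumes f: "f holomorphic_on ball 0 1"
    and A: "(\<integral>\<^sup>+w\<in>ball 0 1. ennreal ((cmod (f w))\<^sup>2) \<partial>lborel) = ennreal A" "0 \<le> A"
  shows "(\<integral>\<^sup>+w\<in>ball 0 1. ennreal ((cmod (f w)) ^ 4 * (1 - (cmod w)\<^sup>2)\<^sup>2) \<partial>lborel) \<le> ennreal (A\<^sup>2 / (3 * pi))"
proof -
  define a where "a n = (deriv ^^ n) f 0 / fact n" for n
  define b where "b n = (cmod (a n))\<^sup>2 / (n + 1)" for n
  define c where "c n = (\<Sum>i\<le>n. a i * a (n - i))" for n
  have b_nonneg: "0 \<le> b n" for n by (simp add: b_def)
  have a_sums: "(\<lambda>n. a n * w ^ n) sums f w" if "cmod w < 1" for w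
    using holomorphic_power_series[OF f, of w] that by (simp add: a_def)
  have c_sums: "(\<lambda>n. c n * w ^ n) sums (f w)\<^sup>2" if w: "cmod w < 1" for w
  proof -
    obtain R where R: "cmod w < R" "R < 1" using w dense by blast
    then have "0 < R" using norm_ge_zero le_less_trans by blast
    then have "summable (\<lambda>n. a n * complex_of_real R ^ n)"
      using a_sums[of "of_real R"] R by (auto simp: sums_iff)
    then have s: "summable (\<lambda>n. norm (a n * w ^ n))"
      by (rule powser_insidea) (use R \<open>0 < R\<close> in auto)
    have "(\<lambda>n. \<Sum>i\<le>n. (a i * w ^ i) * (a (n - i) * w ^ (n - i))) sums
        ((\<Sum>n. a n * w ^ n) * (\<Sum>n. a n * w ^ n))"
      using s s by (rule Cauchy_product_sums)
    moreover have "(\<Sum>i\<le>n. (a i * w ^ i) * (a (n - i) * w ^ (n - i))) = c n * w ^ n" for n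
    proof -
      have "(a i * w ^ i) * (a (n - i) * w ^ (n - i)) = a i * a (n - i) * w ^ n" if "i \<le> n" for i
        using that by (simp add: mult_ac flip: power_add)
      then show ?thesis
        unfolding c_def sum_distrib_right by (intro sum.cong refl) simp
    qed
    ultimately show ?thesis using a_sums[OF w] by (simp add: sums_iff power2_eq_square)
  qed
  have "(\<Sum>n. ennreal (pi * b n)) = ennreal A"
  proof -
    have "(\<integral>\<^sup>+w\<in>ball 0 1. ennreal ((cmod (f w))\<^sup>2 * 1) \<partial>lborel) =
      (\<Sum>n. ennreal ((cmod (a n))\<^sup>2) * (\<integral>\<^sup>+w\<in>ball (0::complex) 1. ennreal (cmod w ^ (2 * n) * 1) \<partial>lborel))"
      using a_sums by (intro Parseval_unit_disc[where \<rho> = "\<lambda>_. 1"]) auto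
    then have "ennreal A = (\<Sum>n. ennreal ((cmod (a n))\<^sup>2) * ennreal (pi / (n + 1)))"
      by (simp only: A mult_1_right nn_integral_unit_disc_even_power)
    also have "\<dots> = (\<Sum>n. ennreal (pi * b n))"
      by (intro suminf_cong) (simp add: b_def mult_ac flip: ennreal_mult')
    finally show ?thesis ..
  qed
  moreover from this have summ: "summable (\<lambda>n. pi * b n)"
    using b_nonneg by (intro summable_suminf_not_top) auto
  moreover have "(\<Sum>n. ennreal (pi * b n)) = ennreal (\<Sum>n. pi * b n)"
    using summ b_nonneg by (intro suminf_ennreal2) auto
  moreover have "0 \<le> (\<Sum>n. pi * b n)"
    using summ b_nonneg by (intro suminf_nonneg) auto
  ultimately have "(\<lambda>n. pi * b n) sums A"
    using A(2) by (simp add: sums_iff)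
  then have "(\<lambda>n. (1 / pi) * (pi * b n)) sums ((1 / pi) * A)" by (rule sums_mult)
  then have b_sums: "b sums (A / pi)" by simp
  then have b_conv: "(\<lambda>n. \<Sum>i\<le>n. b i * b (n - i)) sums ((A / pi) * (A / pi))"
    using Cauchy_product_sums[of b b] b_nonneg by (simp add: sums_iff)
  have "(\<integral>\<^sup>+w\<in>ball 0 1. ennreal ((cmod (f w)) ^ 4 * (1 - (cmod w)\<^sup>2)\<^sup>2) \<partial>lborel) =
      (\<integral>\<^sup>+w\<in>ball 0 1. ennreal ((cmod ((f w)\<^sup>2))\<^sup>2 * (1 - (cmod w)\<^sup>2)\<^sup>2) \<partial>lborel)"
    by (simp add: norm_power)
  also have "\<dots> = (\<Sum>n. ennreal ((cmod (c n))\<^sup>2) *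
      (\<integral>\<^sup>+w\<in>ball (0::complex) 1. ennreal (cmod w ^ (2 * n) * (1 - (cmod w)\<^sup>2)\<^sup>2) \<partial>lborel))"
    using c_sums by (intro Parseval_unit_disc[where \<rho> = "\<lambda>t. (1 - t\<^sup>2)\<^sup>2"]) (auto intro!: continuous_intros)
  also have "\<dots> \<le> (\<Sum>n. ennreal (pi / 3 * (\<Sum>i\<le>n. b i * b (n - i))))"
  proof (intro suminf_le summableI)
    fix n
    have cancel: "(P / 6 * S) * (2 * pi / P) = pi / 3 * S" if "P \<noteq> 0" for P S :: real
      using that by simp
    have "(cmod (c n))\<^sup>2 * (2 * pi / ((real n + 1) * (real n + 2) * (real n + 3))) \<le>
      ((real n + 1) * (real n + 2) * (real n + 3) / 6 * (\<Sum>i\<le>n. b i * b (n - i))) * (2 * pi / ((real n + 1) * (real n + 2) * (real n + 3)))"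
      using Cauchy_product_coefficient_bound[of a n]
      by (intro mult_right_mono) (simp_all add: c_def b_def add_ac)
    also have "\<dots> = pi / 3 * (\<Sum>i\<le>n. b i * b (n - i))"
      by (rule cancel) simp
    finally show "ennreal ((cmod (c n))\<^sup>2) *
      (\<integral>\<^sup>+w\<in>ball (0::complex) 1. ennreal (cmod w ^ (2 * n) * (1 - (cmod w)\<^sup>2)\<^sup>2) \<partial>lborel) \<le>
      ennreal (pi / 3 * (\<Sum>i\<le>n. b i * b (n - i)))"
      unfolding nn_integral_unit_disc_even_power_weighted
      by (subst ennreal_mult[symmetric]) (auto intro!: ennreal_leI)
  qed
  also have "\<dots> = ennreal (\<Sum>n. pi / 3 * (\<Sum>i\<le>n. b i * b (n - i)))"
    using b_conv b_nonneg
    by (intro suminf_ennreal2) (auto intro!: mult_nonneg_nonneg sum_nonneg summable_mult simp: sums_iff)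
  also have "(\<Sum>n. pi / 3 * (\<Sum>i\<le>n. b i * b (n - i))) = A\<^sup>2 / (3 * pi)"
    using sums_mult[OF b_conv, of "pi / 3"] by (simp add: sums_iff power2_eq_square)
  finally show ?thesis .
qed

section \<open>Transfer to the half-plane\<close>

definition cayley :: "complex \<Rightarrow> complex" where
  "cayley w = \<i> * (1 + w) / (1 - w)"

lemma cayley_has_field_derivative:
  assumes "w \<noteq> 1"
  shows "(cayley has_field_derivative 2 * \<i> / (1 - w)\<^sup>2) (at w within A)"
  unfolding cayley_def using assms
  by (auto intro!: derivative_eq_intros simp: divide_simps power2_eq_square) (simp add: algebra_simps)

lemma deriv_cayley: "w \<noteq> 1 \<Longrightarrow> deriv cayley w = 2 * \<i> / (1 - w)\<^sup>2"
  by (intro DERIV_imp_deriv cayley_has_field_derivative)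

lemma cayley_holomorphic: "cayley holomorphic_on ball 0 1"
  unfolding cayley_def by (intro holomorphic_intros) auto

lemma Im_cayley: "Im (cayley w) = (1 - (cmod w)\<^sup>2) / (cmod (1 - w))\<^sup>2"
  by (simp add: cayley_def Im_divide cmod_power2) (simp add: power2_eq_square algebra_simps)

lemma inj_on_cayley: "inj_on cayley (ball 0 1)"
proof (rule inj_on_inverseI[of _ "\<lambda>z. (z - \<i>) / (z + \<i>)"])
  fix w :: complex assume "w \<in> ball 0 1"
  then have w: "1 - w \<noteq> 0" by auto
  then have "cayley w - \<i> = 2 * \<i> * w / (1 - w)" "cayley w + \<i> = 2 * \<i> / (1 - w)"
    by (simp_all add: cayley_def divide_simps) (simp_all add: algebra_simps)
  then show "(cayley w - \<i>) / (cayley w + \<i>) = w" using w by simp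
qed

lemma cayley_image: "cayley ` ball 0 1 = upper_half_plane"
proof (intro equalityI subsetI)
  fix z assume "z \<in> cayley ` ball 0 1"
  then obtain w where w: "z = cayley w" "cmod w < 1" by auto
  moreover have "(cmod w)\<^sup>2 < 1" using w by (simp add: abs_square_less_1)
  ultimately show "z \<in> upper_half_plane"
    by (auto simp: upper_half_plane_def Im_cayley intro!: divide_pos_pos)
next
  fix z assume "z \<in> upper_half_plane"
  then have z: "0 < Im z" by (simp add: upper_half_plane_def)
  then have nz: "z + \<i> \<noteq> 0" by (auto simp: complex_eq_iff)
  define w where "w = (z - \<i>) / (z + \<i>)"
  have "(cmod (z - \<i>))\<^sup>2 < (cmod (z + \<i>))\<^sup>2"
    using z by (simp add: cmod_power2) (simp add: power2_eq_square algebra_simps)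
  then have "cmod (z - \<i>) < cmod (z + \<i>)" by (rule power_less_imp_less_base) simp
  then have "cmod w < 1" using nz by (simp add: w_def norm_divide)
  moreover have "z = cayley w"
  proof -
    have "1 - w = 2 * \<i> / (z + \<i>)" "1 + w = 2 * z / (z + \<i>)"
      using nz by (simp_all add: w_def divide_simps)
    then show ?thesis using nz by (simp add: cayley_def)
  qed
  ultimately show "z \<in> cayley ` ball 0 1" by auto
qed

text \<open>
  Since \<open>|\<phi>'(w)| = 2 / |1 - w|\<^sup>2\<close> for the Cayley map \<open>\<phi>\<close>, one has
  \<open>Im \<phi>(w) = |\<phi>'(w)| (1 - |w|\<^sup>2) / 2\<close>. Hence both integrals are integrals of
  \<open>f = (F \<circ> \<phi>) \<phi>'\<close> over the disc, and the second acquires the factor \<open>1/4\<close> that turns \<open>3 \<pi>\<close> into \<open>12 \<pi>\<close>.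
\<close>
theorem half_plane_L4_contraction:
  assumes F: "F holomorphic_on upper_half_plane"
    and A: "(\<integral>\<^sup>+z\<in>upper_half_plane. ennreal ((cmod (F z))\<^sup>2) \<partial>lborel) = ennreal A" "0 \<le> A"
  shows "(\<integral>\<^sup>+z\<in>upper_half_plane. ennreal ((cmod (F z)) ^ 4 * (Im z)\<^sup>2) \<partial>lborel) \<le> ennreal (A\<^sup>2 / (12 * pi))"
proof -
  define f where "f w = F (cayley w) * deriv cayley w" for w
  have f: "f holomorphic_on ball 0 1"
    unfolding f_def
    using holomorphic_on_compose[OF cayley_holomorphic, of F] F
    by (intro holomorphic_on_mult holomorphic_deriv cayley_holomorphic) (simp_all add: cayley_image comp_def)
  have cont: "continuous_on upper_half_plane F"
    using F by (rule holomorphic_on_imp_continuous_on)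
  note cov = nn_integral_holomorphic_change_of_variables[OF open_ball cayley_holomorphic inj_on_cayley,
      unfolded cayley_image]
  have "ennreal A = (\<integral>\<^sup>+w\<in>ball 0 1. ennreal ((cmod (deriv cayley w))\<^sup>2 * (cmod (F (cayley w)))\<^sup>2) \<partial>lborel)"
    unfolding A(1)[symmetric] by (intro cov continuous_intros cont) auto
  then have "(\<integral>\<^sup>+w\<in>ball 0 1. ennreal ((cmod (f w))\<^sup>2) \<partial>lborel) = ennreal A"
    by (simp add: f_def norm_mult power_mult_distrib mult.commute)
  note bound = unit_disc_L4_contraction[OF f this A(2)]
  have "(\<integral>\<^sup>+z\<in>upper_half_plane. ennreal ((cmod (F z)) ^ 4 * (Im z)\<^sup>2) \<partial>lborel) =
    (\<integral>\<^sup>+w\<in>ball 0 1. ennreal ((cmod (deriv cayley w))\<^sup>2 * ((cmod (F (cayley w))) ^ 4 * (Im (cayley w))\<^sup>2)) \<partial>lborel)"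
    by (intro cov continuous_intros cont) auto
  also have "\<dots> = (\<integral>\<^sup>+w. ennreal (1 / 4) * (ennreal ((cmod (f w)) ^ 4 * (1 - (cmod w)\<^sup>2)\<^sup>2) * indicator (ball 0 1) w) \<partial>lborel)"
  proof (rule nn_integral_cong)
    fix w :: complex
    show "ennreal ((cmod (deriv cayley w))\<^sup>2 * ((cmod (F (cayley w))) ^ 4 * (Im (cayley w))\<^sup>2)) * indicator (ball 0 1) w =
      ennreal (1 / 4) * (ennreal ((cmod (f w)) ^ 4 * (1 - (cmod w)\<^sup>2)\<^sup>2) * indicator (ball 0 1) w)"
    proof (cases "cmod w < 1")
      case True
      define q where "q = cmod (1 - w)"
      have q: "q \<noteq> 0" using True by (auto simp: q_def)
      have d: "cmod (deriv cayley w) = 2 / q\<^sup>2"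
        using True by (subst deriv_cayley) (auto simp: norm_divide norm_mult norm_power q_def)
      have eq: "(cmod (deriv cayley w))\<^sup>2 * ((cmod (F (cayley w))) ^ 4 * (Im (cayley w))\<^sup>2) =
        1 / 4 * ((cmod (f w)) ^ 4 * (1 - (cmod w)\<^sup>2)\<^sup>2)"
        unfolding f_def norm_mult d Im_cayley q_def[symmetric] using q
        by (simp add: power_mult_distrib power_divide field_simps flip: power_mult power_add)
      have "ennreal ((cmod (deriv cayley w))\<^sup>2 * ((cmod (F (cayley w))) ^ 4 * (Im (cayley w))\<^sup>2)) =
        ennreal (1 / 4) * ennreal ((cmod (f w)) ^ 4 * (1 - (cmod w)\<^sup>2)\<^sup>2)"
        unfolding eq by (rule ennreal_mult') simp
      then show ?thesis using True by simp
    qed simp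
  qed
  also have "\<dots> = ennreal (1 / 4) * (\<integral>\<^sup>+w\<in>ball 0 1. ennreal ((cmod (f w)) ^ 4 * (1 - (cmod w)\<^sup>2)\<^sup>2) \<partial>lborel)"
  proof (rule nn_integral_cmult)
    have "(\<lambda>w. ennreal (indicator (ball 0 1) w *\<^sub>R ((cmod (f w)) ^ 4 * (1 - (cmod w)\<^sup>2)\<^sup>2))) \<in> borel_measurable borel"
      by (intro measurable_compose[OF _ measurable_ennreal] borel_measurable_continuous_on_indicator
          continuous_intros holomorphic_on_imp_continuous_on f) auto
    also have "(\<lambda>w. ennreal (indicator (ball 0 1) w *\<^sub>R ((cmod (f w)) ^ 4 * (1 - (cmod w)\<^sup>2)\<^sup>2))) =
      (\<lambda>w. ennreal ((cmod (f w)) ^ 4 * (1 - (cmod w)\<^sup>2)\<^sup>2) * indicator (ball 0 1) w)"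
      by (auto simp: indicator_def)
    finally show "(\<lambda>w. ennreal ((cmod (f w)) ^ 4 * (1 - (cmod w)\<^sup>2)\<^sup>2) * indicator (ball 0 1) w) \<in> borel_measurable lborel"
      by (simp only: measurable_lborel2)
  qed
  also have "\<dots> \<le> ennreal (1 / 4) * ennreal (A\<^sup>2 / (3 * pi))"
    by (intro mult_left_mono bound) simp
  also have "\<dots> = ennreal (A\<^sup>2 / (12 * pi))"
    by (subst ennreal_mult'[symmetric]) simp_all
  finally show ?thesis .
qed

section \<open>The entropy inequality\<close>

text \<open>
  The tangent line of the logarithm at \<open>1\<close>, evaluated at \<open>3 u\<^sup>2\<close> with \<open>u = 2 \<surd>\<pi> |F z| Im z\<close>: the
  factor 3 is the reciprocal of the bound for the mean of \<open>u\<^sup>2\<close>. At a zero of \<open>F\<close> both sides vanish.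
\<close>
lemma entropy_integrand_lower_bound:
  assumes "0 < Im z"
  shows "(1 + ln 3) / 2 * (cmod (F z))\<^sup>2 \<le> entropy_integrand F z + 6 * pi * ((cmod (F z)) ^ 4 * (Im z)\<^sup>2)"
proof (cases "F z = 0")
  case True
  then show ?thesis by (simp add: entropy_integrand_def)
next
  case False
  define u where "u = 2 * sqrt pi * cmod (F z) * Im z"
  have u: "u > 0" using False assms by (simp add: u_def)
  have u2: "u\<^sup>2 = 4 * pi * ((cmod (F z))\<^sup>2 * (Im z)\<^sup>2)" by (simp add: u_def power_mult_distrib)
  have "ln (3 * u\<^sup>2) \<le> 3 * u\<^sup>2 - 1" using u by (intro ln_le_minus_one) simp
  moreover have "ln (3 * u\<^sup>2) = ln 3 + 2 * ln u" using u by (simp add: ln_mult ln_realpow)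
  ultimately have "(1 + ln 3) / 2 \<le> ln (1 / u) + 3 / 2 * u\<^sup>2"
    using u by (simp add: ln_div)
  then have "(1 + ln 3) / 2 * (cmod (F z))\<^sup>2 \<le> (ln (1 / u) + 3 / 2 * u\<^sup>2) * (cmod (F z))\<^sup>2"
    by (rule mult_right_mono) simp
  also have "\<dots> = entropy_integrand F z + 6 * pi * ((cmod (F z)) ^ 4 * (Im z)\<^sup>2)"
    unfolding u2 by (simp add: entropy_integrand_def u_def power4_eq_xxxx power2_eq_square algebra_simps)
  finally show ?thesis .
qed

theorem theorem1p6:
  fixes F :: "complex \<Rightarrow> complex"
  assumes "F \<in> bergman_space"
    and "bergman_norm F = 1"
  shows "set_quasi_integrable lborel upper_half_plane (entropy_integrand F) \<and>
         set_ereal_integral lborel upper_half_plane (entropy_integrand F) \<ge> ereal (ln 3 / 2)"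
proof -
  let ?H = upper_half_plane
  let ?E = "entropy_integrand F"
  have F: "F holomorphic_on ?H" and int: "set_integrable lborel ?H (\<lambda>z. (cmod (F z))\<^sup>2)"
    using assms(1) by (simp_all add: bergman_space_def)
  have "open ?H"
    unfolding upper_half_plane_def by (rule open_halfspace_Im_gt)
  then have [measurable]: "?H \<in> sets borel" by simp
  \<comment> \<open>\<open>F\<close> is arbitrary off the half-plane; its extension by zero is Borel measurable.\<close>
  define F0 where "F0 z = indicator ?H z *\<^sub>R F z" for z
  have [measurable]: "F0 \<in> borel_measurable borel"
    unfolding F0_def
    by (intro borel_measurable_continuous_on_indicator holomorphic_on_imp_continuous_on F) simp
  have [measurable]: "Im \<in> borel_measurable borel"
    by (intro borel_measurable_continuous_onI continuous_intros)
  let ?P = "\<integral>\<^sup>+z\<in>?H. ennreal (?E z) \<partial>lborel"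
  let ?N = "\<integral>\<^sup>+z\<in>?H. ennreal (- ?E z) \<partial>lborel"
  let ?B = "\<integral>\<^sup>+z\<in>?H. ennreal (6 * pi * ((cmod (F z)) ^ 4 * (Im z)\<^sup>2)) \<partial>lborel"
  have E0: "indicator ?H z *\<^sub>R ?E z = indicator ?H z *\<^sub>R entropy_integrand F0 z" for z
    by (simp add: entropy_integrand_def F0_def indicator_def)
  have [measurable]: "entropy_integrand F0 \<in> borel_measurable borel"
    unfolding entropy_integrand_def by measurable
  have meas:
    "(\<lambda>z. ennreal (?E z) * indicator ?H z) \<in> borel_measurable lborel"
    "(\<lambda>z. ennreal (- ?E z) * indicator ?H z) \<in> borel_measurable lborel"
    "(\<lambda>z. ennreal ((cmod (F z)) ^ 4 * (Im z)\<^sup>2) * indicator ?H z) \<in> borel_measurable lborel"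
    "(\<lambda>z. ennreal ((cmod (F z))\<^sup>2) * indicator ?H z) \<in> borel_measurable lborel"
  proof -
    have "(\<lambda>z. ennreal (entropy_integrand F0 z) * indicator ?H z) \<in> borel_measurable lborel"
      by measurable
    also have "(\<lambda>z. ennreal (entropy_integrand F0 z) * indicator ?H z) = (\<lambda>z. ennreal (?E z) * indicator ?H z)"
      by (auto simp: fun_eq_iff indicator_def entropy_integrand_def F0_def)
    finally show "(\<lambda>z. ennreal (?E z) * indicator ?H z) \<in> borel_measurable lborel" .
    have "(\<lambda>z. ennreal (- entropy_integrand F0 z) * indicator ?H z) \<in> borel_measurable lborel"
      by measurable
    also have "(\<lambda>z. ennreal (- entropy_integrand F0 z) * indicator ?H z) = (\<lambda>z. ennreal (- ?E z) * indicator ?H z)"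
      by (auto simp: fun_eq_iff indicator_def entropy_integrand_def F0_def)
    finally show "(\<lambda>z. ennreal (- ?E z) * indicator ?H z) \<in> borel_measurable lborel" .
    have "(\<lambda>z. ennreal ((cmod (F0 z)) ^ 4 * (Im z)\<^sup>2) * indicator ?H z) \<in> borel_measurable lborel"
      by measurable
    also have "(\<lambda>z. ennreal ((cmod (F0 z)) ^ 4 * (Im z)\<^sup>2) * indicator ?H z) =
        (\<lambda>z. ennreal ((cmod (F z)) ^ 4 * (Im z)\<^sup>2) * indicator ?H z)"
      by (auto simp: fun_eq_iff indicator_def F0_def)
    finally show "(\<lambda>z. ennreal ((cmod (F z)) ^ 4 * (Im z)\<^sup>2) * indicator ?H z) \<in> borel_measurable lborel" .
    have "(\<lambda>z. ennreal ((cmod (F0 z))\<^sup>2) * indicator ?H z) \<in> borel_measurable lborel"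
      by measurable
    also have "(\<lambda>z. ennreal ((cmod (F0 z))\<^sup>2) * indicator ?H z) =
        (\<lambda>z. ennreal ((cmod (F z))\<^sup>2) * indicator ?H z)"
      by (auto simp: fun_eq_iff indicator_def F0_def)
    finally show "(\<lambda>z. ennreal ((cmod (F z))\<^sup>2) * indicator ?H z) \<in> borel_measurable lborel" .
  qed
  have scale: "ennreal (c * x) * indicator ?H z = ennreal c * (ennreal x * indicator ?H z)"
    if "0 \<le> c" for c x z
    using that by (simp add: ennreal_mult' mult.assoc)
  have measB: "(\<lambda>z. ennreal (6 * pi * ((cmod (F z)) ^ 4 * (Im z)\<^sup>2)) * indicator ?H z) \<in> borel_measurable lborel"
    using meas(3) by (subst scale) simp_all
  have measA: "(\<lambda>z. ennreal ((1 + ln 3) / 2 * (cmod (F z))\<^sup>2) * indicator ?H z) \<in> borel_measurable lborel"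
    using meas(4) by (subst scale) simp_all
  have one: "(\<integral>\<^sup>+z\<in>?H. ennreal ((cmod (F z))\<^sup>2) \<partial>lborel) = ennreal 1"
  proof -
    have "(LINT z:?H|lborel. (cmod (F z))\<^sup>2) = 1"
      using assms(2) by (simp add: bergman_norm_def)
    moreover have "(\<integral>\<^sup>+z. ennreal (indicator ?H z *\<^sub>R (cmod (F z))\<^sup>2) \<partial>lborel) =
        ennreal (LINT z:?H|lborel. (cmod (F z))\<^sup>2)"
      using int unfolding set_integrable_def set_lebesgue_integral_def
      by (intro nn_integral_eq_integral) auto
    moreover have "(\<integral>\<^sup>+z\<in>?H. ennreal ((cmod (F z))\<^sup>2) \<partial>lborel) =
        (\<integral>\<^sup>+z. ennreal (indicator ?H z *\<^sub>R (cmod (F z))\<^sup>2) \<partial>lborel)"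
      by (intro nn_integral_cong) (simp add: indicator_def)
    ultimately show ?thesis by simp
  qed
  have A: "(\<integral>\<^sup>+z\<in>?H. ennreal ((1 + ln 3) / 2 * (cmod (F z))\<^sup>2) \<partial>lborel) = ennreal ((1 + ln 3) / 2)"
  proof -
    have "(\<integral>\<^sup>+z\<in>?H. ennreal ((1 + ln 3) / 2 * (cmod (F z))\<^sup>2) \<partial>lborel) =
      ennreal ((1 + ln 3) / 2) * (\<integral>\<^sup>+z\<in>?H. ennreal ((cmod (F z))\<^sup>2) \<partial>lborel)"
      by (subst scale, simp) (rule nn_integral_cmult[OF meas(4)])
    then show ?thesis by (simp only: one ennreal_1 mult_1_right)
  qed
  have B: "?B \<le> ennreal (1 / 2)"
  proof -
    have "?B = ennreal (6 * pi) * (\<integral>\<^sup>+z\<in>?H. ennreal ((cmod (F z)) ^ 4 * (Im z)\<^sup>2) \<partial>lborel)"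
      by (subst scale, simp) (rule nn_integral_cmult[OF meas(3)])
    also have "\<dots> \<le> ennreal (6 * pi) * ennreal (1\<^sup>2 / (12 * pi))"
      by (intro mult_left_mono half_plane_L4_contraction F one) simp_all
    also have "\<dots> = ennreal (1 / 2)"
      by (subst ennreal_mult'[symmetric]) simp_all
    finally show ?thesis .
  qed
  have lower: "(1 + ln 3) / 2 * (cmod (F z))\<^sup>2 \<le> ?E z + 6 * pi * ((cmod (F z)) ^ 4 * (Im z)\<^sup>2)"
    if "z \<in> ?H" for z
    using that by (intro entropy_integrand_lower_bound) (simp add: upper_half_plane_def)
  have "?N \<le> ?B"
  proof (intro nn_integral_mono)
    fix z
    have "- ?E z \<le> 6 * pi * ((cmod (F z)) ^ 4 * (Im z)\<^sup>2)" if "z \<in> ?H"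
    proof -
      have "0 \<le> (1 + ln 3) / 2 * (cmod (F z))\<^sup>2" by simp
      then show ?thesis using lower[OF that] by linarith
    qed
    then show "ennreal (- ?E z) * indicator ?H z \<le>
        ennreal (6 * pi * ((cmod (F z)) ^ 4 * (Im z)\<^sup>2)) * indicator ?H z"
      by (auto simp: indicator_def intro!: ennreal_leI)
  qed
  then have N: "?N \<le> ennreal (1 / 2)" using B by (rule order_trans)
  then have N_fin: "?N < \<infinity>" by (rule le_less_trans) (simp only: infinity_ennreal_def ennreal_less_top)
  \<comment> \<open>The pointwise bound with the negative part moved to the other side, so that all terms are
    nonnegative and can be integrated although \<open>?P\<close> may be infinite.\<close>
  have "ennreal ((1 + ln 3) / 2) + ?N \<le> ?P + ?B"
  proof -
    have "ennreal ((1 + ln 3) / 2) + ?N =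
      (\<integral>\<^sup>+z. ennreal ((1 + ln 3) / 2 * (cmod (F z))\<^sup>2) * indicator ?H z + ennreal (- ?E z) * indicator ?H z \<partial>lborel)"
      unfolding A[symmetric] by (rule nn_integral_add[symmetric]) (rule measA meas(2))+
    also have "\<dots> \<le> (\<integral>\<^sup>+z. ennreal (?E z) * indicator ?H z +
        ennreal (6 * pi * ((cmod (F z)) ^ 4 * (Im z)\<^sup>2)) * indicator ?H z \<partial>lborel)"
    proof (intro nn_integral_mono)
      fix z
      show "ennreal ((1 + ln 3) / 2 * (cmod (F z))\<^sup>2) * indicator ?H z + ennreal (- ?E z) * indicator ?H z \<le>
        ennreal (?E z) * indicator ?H z + ennreal (6 * pi * ((cmod (F z)) ^ 4 * (Im z)\<^sup>2)) * indicator ?H z"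
      proof (cases "z \<in> ?H")
        case True
        define a b e where "a = (1 + ln 3) / 2 * (cmod (F z))\<^sup>2" and "b = 6 * pi * ((cmod (F z)) ^ 4 * (Im z)\<^sup>2)" and "e = ?E z"
        have ab: "0 \<le> a" "0 \<le> b" "a \<le> e + b"
          using lower[OF True] by (simp_all add: a_def b_def e_def)
        have "ennreal a + ennreal (- e) \<le> ennreal e + ennreal b"
        proof (cases "0 \<le> e")
          case True
          then show ?thesis using ab by (simp add: ennreal_neg flip: ennreal_plus)
        next
          case False
          then have "ennreal a + ennreal (- e) = ennreal (a - e)"
            using ab by (subst ennreal_plus[symmetric]) auto
          then show ?thesis using False ab by (simp add: ennreal_neg ennreal_leI)
        qed
        then show ?thesis using True by (simp add: a_def b_def e_def)
      qed simp
    qed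
    also have "\<dots> = ?P + ?B" by (rule nn_integral_add) (rule meas(1) measB)+
    finally show ?thesis .
  qed
  also have "\<dots> \<le> ?P + ennreal (1 / 2)" using B by (rule add_left_mono)
  finally have main: "ennreal ((1 + ln 3) / 2) + ?N \<le> ?P + ennreal (1 / 2)" .
  \<comment> \<open>Only \<open>?N\<close> is subtracted in the extended reals, and it is finite.\<close>
  obtain n where n: "?N = ennreal n" "0 \<le> n"
    using N_fin by (cases ?N rule: ennreal_cases) auto
  have "ereal (ln 3 / 2) \<le> enn2ereal ?P - enn2ereal ?N"
  proof (cases ?P rule: ennreal_cases)
    case (real p)
    then have "ennreal ((1 + ln 3) / 2 + n) \<le> ennreal (p + 1 / 2)"
      using main n by simp
    then have "(1 + ln 3) / 2 + n \<le> p + 1 / 2"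
      using real by (subst (asm) ennreal_le_iff) auto
    then show ?thesis using real n by (simp add: enn2ereal_ennreal field_simps)
  next
    case top
    then show ?thesis using n by (simp add: enn2ereal_ennreal)
  qed
  moreover have "set_borel_measurable lborel ?H ?E"
    unfolding set_borel_measurable_def E0 by measurable
  ultimately show ?thesis
    using N_fin by (simp add: set_quasi_integrable_def set_ereal_integral_def)
qed

end
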